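(* Let $p\ge 0$ be an integer, $N=(p+1)^2$, and let $\phi_1,\dots,\phi_N$ be linearly independent real polynomials in $\mathbf{x}=(x,y)\in\mathbb{R}^2$; write $\boldsymbol{\phi}(\mathbf{x})=[\phi_1(\mathbf{x}),\dots,\phi_N(\mathbf{x})]^T\in\mathbb{R}^N$. Let $K\ge 1$, let $\bar{\mathbf{x}}_1,\dots,\bar{\mathbf{x}}_K\in\mathbb{R}^2$ be points on the real boundary, and let $\Phi=\Phi(\bar{\mathbf{x}})\in\mathbb{R}^{N\times K}$ be the matrix with entries $\Phi_{jk}=\phi_j(\bar{\mathbf{x}}_k)$. Assume that the matrix $$\begin{bmatrix} I & \Phi\\ \Phi^T & 0\end{bmatrix}$$ is invertible, where $I$ is the $N\times N$ identity matrix. Let $\tilde{\mathbf{x}}\in\mathbb{R}^2$ be a point on the computational boundary. For every $\mathbf{u}\in\mathbb{R}^N$ and $\mathbf{u}_D\in\mathbb{R}^K$, let $(\mathbf{v},\boldsymbol{\lambda})\in\mathbb{R}^N\times\mathbb{R}^K$ be the solution of the ROD2D-E linear system $$\begin{bmatrix} I & \Phi\\ \Phi^T & 0\end{bmatrix}\begin{bmatrix}\mathbf{v}\\ \boldsymbol{\lambda}\end{bmatrix}=\begin{bmatrix}\mathbf{u}\\ \mathbf{u}_D\end{bmatrix},$$ and let $v_h(\mathbf{x})=\boldsymbol{\phi}(\mathbf{x})^T\mathbf{v}$. Then computing $v_h(\tilde{\mathbf{x}})$ in this way is equivalent to the polynomial correction $$v_h(\tilde{\mathbf{x}})=[\boldsymbol{\phi}^{\text{ROD2D-E}}(\tilde{\mathbf{x}})]^T\mathbf{u}+[\boldsymbol{\alpha}^{\text{ROD2D-E}}]^T\mathbf{u}_D,$$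 i.e. this equality holds for all $\mathbf{u}$ and $\mathbf{u}_D$, where $$[\boldsymbol{\alpha}^{\text{ROD2D-E}}]^T=\boldsymbol{\phi}(\tilde{\mathbf{x}})^T\Phi\,(\Phi^T\Phi)^{-1},\qquad \boldsymbol{\phi}^{\text{ROD2D-E}}(\tilde{\mathbf{x}})=\boldsymbol{\phi}(\tilde{\mathbf{x}})-\Phi\,\boldsymbol{\alpha}^{\text{ROD2D-E}}.$$
   Context: Setting: in a two-dimensional discontinuous Galerkin method, the numerical solution in a boundary element $\Omega_b$ is $u_h(\mathbf{x})=\boldsymbol{\phi}(\mathbf{x})^T\mathbf{u}$, a polynomial approximation of degree $p$ with coefficient vector $\mathbf{u}\in\mathbb{R}^N$, $N=(p+1)^2$. Basis functions are polynomials and are evaluated also outside the element. Dirichlet values $\mathbf{u}_D=[u_D(\bar{\mathbf{x}}_1),\dots,u_D(\bar{\mathbf{x}}_K)]^T$ are prescribed at $K$ points $\bar{\mathbf{x}}_k$ of the real boundary, which need not coincide with the computational boundary. The ROD2D-E (Reconstruction for Off-site Data, Euclidean distance, multiple constraints) method defines a modified polynomial $v_h(\mathbf{x})=\boldsymbol{\phi}(\mathbf{x})^T\mathbf{v}$ whose coefficients minimize $\frac12\|\mathbf{v}-\mathbf{u}\|_2^2$ subject to $v_h(\bar{\mathbf{x}}_k)=u_D(\bar{\mathbf{x}}_k)$ for $k=1,\dots,K$. The linear system in the claim consists of the optimality conditions of the Lagrangian $\mathcal{L}(\mathbf{v},\boldsymbol{\lambda})=\frac12\|\mathbf{v}-\mathbf{u}\|_2^2+\sum_{k=1}^K\lambda_k(v_h(\bar{\mathbf{x}}_k)-u_D(\bar{\mathbf{x}}_k))$.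 The value $v_h(\tilde{\mathbf{x}})$ is the modified boundary condition imposed at $\tilde{\mathbf{x}}$. *)

theory Defs
  imports "HOL-Analysis.Analysis"
begin

(* Polynomials in (x, y) are identified with the polynomial functions on real ^ 2
   (real_polynomial_function), so linear independence is that of functions. It is stated for
   the indexed family: the library's independent is about sets and is insensitive to
   repetitions; moreover functions are not an instance of real_vector. *)
definition linearly_independent_family :: "('n::finite \<Rightarrow> 'a \<Rightarrow> real) \<Rightarrow> bool" where
  "linearly_independent_family \<phi> \<longleftrightarrow>
     (\<forall>c. (\<forall>x. (\<Sum>j\<in>UNIV. c j * \<phi> j x) = 0) \<longrightarrow> (\<forall>j. c j = 0))"

definition basis_vec :: "('n::finite \<Rightarrow> 'a \<Rightarrow> real) \<Rightarrow> 'a \<Rightarrow> real ^ 'n" where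
  "basis_vec \<phi> x = (\<chi> j. \<phi> j x)"

definition expansion :: "('n::finite \<Rightarrow> 'a \<Rightarrow> real) \<Rightarrow> real ^ 'n \<Rightarrow> 'a \<Rightarrow> real" where
  "expansion \<phi> v x = basis_vec \<phi> x \<bullet> v"

definition collocation_matrix ::
    "('n::finite \<Rightarrow> 'a \<Rightarrow> real) \<Rightarrow> ('k::finite \<Rightarrow> 'a) \<Rightarrow> real ^ 'k ^ 'n" where
  "collocation_matrix \<phi> xbar = (\<chi> j k. \<phi> j (xbar k))"

(* Block rows and columns are indexed by sum types: Inl is the first block, Inr the second. *)
definition block_vector :: "real ^ 'n \<Rightarrow> real ^ 'k \<Rightarrow> real ^ ('n::finite + 'k::finite)" where
  "block_vector a b = (\<chi> i. case i of Inl j \<Rightarrow> a $ j | Inr k \<Rightarrow> b $ k)"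

definition block_matrix ::
    "real ^ 'c ^ 'a \<Rightarrow> real ^ 'd ^ 'a \<Rightarrow> real ^ 'c ^ 'b \<Rightarrow> real ^ 'd ^ 'b
      \<Rightarrow> real ^ ('c::finite + 'd::finite) ^ ('a::finite + 'b::finite)" where
  "block_matrix A B C D =
     (\<chi> i. case i of Inl r \<Rightarrow> block_vector (A $ r) (B $ r) | Inr s \<Rightarrow> block_vector (C $ s) (D $ s))"

definition ROD_matrix :: "real ^ 'k ^ 'n \<Rightarrow> real ^ ('n::finite + 'k::finite) ^ ('n + 'k)" where
  "ROD_matrix \<Phi> = block_matrix (mat 1) \<Phi> (transpose \<Phi>) 0"

definition ROD_solution ::
    "real ^ 'k ^ 'n \<Rightarrow> real ^ 'n \<Rightarrow> real ^ 'k \<Rightarrow> real ^ 'n::finite \<Rightarrow> real ^ 'k::finite \<Rightarrow> bool" where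
  "ROD_solution \<Phi> u u\<^sub>D v l \<longleftrightarrow> ROD_matrix \<Phi> *v block_vector v l = block_vector u u\<^sub>D"

(* The row vector phi(xt)^T Phi (Phi^T Phi)^(-1); v* is row vector times matrix. *)
definition ROD_alpha ::
    "('n::finite \<Rightarrow> 'a \<Rightarrow> real) \<Rightarrow> ('k::finite \<Rightarrow> 'a) \<Rightarrow> 'a \<Rightarrow> real ^ 'k" where
  "ROD_alpha \<phi> xbar xt =
     (let \<Phi> = collocation_matrix \<phi> xbar
      in (basis_vec \<phi> xt v* \<Phi>) v* matrix_inv (transpose \<Phi> ** \<Phi>))"

definition ROD_phi ::
    "('n::finite \<Rightarrow> 'a \<Rightarrow> real) \<Rightarrow> ('k::finite \<Rightarrow> 'a) \<Rightarrow> 'a \<Rightarrow> real ^ 'n" where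
  "ROD_phi \<phi> xbar xt = basis_vec \<phi> xt - collocation_matrix \<phi> xbar *v ROD_alpha \<phi> xbar xt"

end

theory Submission
  imports Defs
begin

text \<open>
  Eliminating \<open>v\<close> from the two block rows \<open>v + \<Phi> l = u\<close> and \<open>\<Phi>\<^sup>T v = u\<^sub>D\<close>
  gives \<open>(\<Phi>\<^sup>T \<Phi>) l = \<Phi>\<^sup>T u - u\<^sub>D\<close>. The Gram matrix is invertible because
  \<open>\<Phi>\<^sup>T \<Phi> w = 0\<close> forces \<open>\<Phi> w = 0\<close>, which puts \<open>(0, w)\<close> in the kernel of
  the saddle point matrix.
\<close>

lemma block_vector_eq_iff [simp]:
  "block_vector a b = block_vector c d \<longleftrightarrow> a = c \<and> b = d"
proof
  assume eq: "block_vector a b = block_vector c d"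
  have "a $ i = c $ i" for i
    using arg_cong[OF eq, of "\<lambda>z. z $ Inl i"] by (simp add: block_vector_def)
  moreover have "b $ i = d $ i" for i
    using arg_cong[OF eq, of "\<lambda>z. z $ Inr i"] by (simp add: block_vector_def)
  ultimately show "a = c \<and> b = d"
    by (simp add: vec_eq_iff)
qed simp

lemma block_vector_cases:
  obtains a b where "z = block_vector a b"
proof
  show "z = block_vector (\<chi> j. z $ Inl j) (\<chi> k. z $ Inr k)"
    by (simp add: block_vector_def vec_eq_iff split: sum.split)
qed

text \<open>Splits each row sum of a block matrix into the contributions of its two column
  blocks.\<close>

lemma sum_UNIV_sum_type:
  fixes f :: "'a::finite + 'b::finite \<Rightarrow> 'c::comm_monoid_add"
  shows "sum f UNIV = (\<Sum>a\<in>UNIV. f (Inl a)) + (\<Sum>b\<in>UNIV. f (Inr b))"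
  using sum.Plus[of "UNIV :: 'a set" "UNIV :: 'b set" f] by (simp add: comp_def)

lemma block_matrix_vector_mult:
  "block_matrix A B C D *v block_vector a b = block_vector (A *v a + B *v b) (C *v a + D *v b)"
proof -
  have "(block_matrix A B C D *v block_vector a b) $ i =
      block_vector (A *v a + B *v b) (C *v a + D *v b) $ i" for i
    by (cases i) (simp_all add: block_matrix_def block_vector_def matrix_vector_mult_def
        sum_UNIV_sum_type)
  then show ?thesis
    by (simp only: vec_eq_iff) simp
qed

text \<open>The block rows are the optimality conditions of the Lagrangian: stationarity in
  \<open>v\<close>, then the constraints.\<close>

lemma ROD_solution_iff:
  "ROD_solution \<Phi> u u\<^sub>D v l \<longleftrightarrow> v + \<Phi> *v l = u \<and> transpose \<Phi> *v v = u\<^sub>D"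
  by (simp add: ROD_solution_def ROD_matrix_def block_matrix_vector_mult)

text \<open>\<open>matrix_inv\<close> is a Hilbert choice, so its two equations hold only once a
  witness exists, which invertibility supplies.\<close>

lemma matrix_inv_mult:
  fixes A :: "real ^ 'n ^ 'n"
  assumes "invertible A"
  shows "A ** matrix_inv A = mat 1" and "matrix_inv A ** A = mat 1"
  unfolding matrix_inv_def
  using someI_ex[OF assms[unfolded invertible_def]] by blast+

lemma ROD_solution_exists_unique:
  assumes inv: "invertible (ROD_matrix \<Phi>)"
  shows "\<exists>!(v, l). ROD_solution \<Phi> u u\<^sub>D v l"
proof -
  obtain v l where vl: "matrix_inv (ROD_matrix \<Phi>) *v block_vector u u\<^sub>D = block_vector v l"
    by (rule block_vector_cases)
  then have sol: "ROD_solution \<Phi> u u\<^sub>D v l"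
    \<comment> \<open>The flipped equation folds the blocks back into inverse times right-hand side,
      where the matrix cancels.\<close>
    by (simp add: ROD_solution_def flip: vl)
      (simp add: matrix_vector_mul_assoc matrix_inv_mult(1)[OF inv])
  have uniq: "v' = v \<and> l' = l" if "ROD_solution \<Phi> u u\<^sub>D v' l'" for v' l'
  proof -
    have "ROD_matrix \<Phi> *v block_vector v' l' = ROD_matrix \<Phi> *v block_vector v l"
      using that sol by (simp add: ROD_solution_def)
    then have "block_vector v' l' = block_vector v l"
      by (rule injD[OF inj_matrix_vector_mult[OF inv]])
    then show ?thesis
      by simp
  qed
  show ?thesis
  proof (rule ex1I[of _ "(v, l)"])
    show "z = (v, l)" if "case z of (v, l) \<Rightarrow> ROD_solution \<Phi> u u\<^sub>D v l" for z
      using that uniq[of "fst z" "snd z"] by (simp add: case_prod_beta prod_eq_iff)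
  qed (simp add: sol)
qed

lemma invertible_gram_matrix:
  fixes \<Phi> :: "real ^ 'k ^ 'n"
  assumes inv: "invertible (ROD_matrix \<Phi>)"
  shows "invertible (transpose \<Phi> ** \<Phi>)"
proof -
  have "w = 0" if "(transpose \<Phi> ** \<Phi>) *v w = 0" for w
  proof -
    \<comment> \<open>Pairing the kernel equation with \<open>w\<close> gives the squared norm of
      \<open>\<Phi> *v w\<close>, which must therefore vanish.\<close>
    have "(\<Phi> *v w) \<bullet> (\<Phi> *v w) = w \<bullet> ((transpose \<Phi> ** \<Phi>) *v w)"
      by (metis dot_lmul_matrix matrix_vector_mul_assoc transpose_transpose
          transpose_matrix_vector)
    then have "\<Phi> *v w = 0"
      using that by simp
    then have "ROD_solution \<Phi> 0 0 0 w" and "ROD_solution \<Phi> 0 0 0 0"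
      by (simp_all add: ROD_solution_iff)
    then show ?thesis
      using ROD_solution_exists_unique[OF inv, of 0 0] by auto
  qed
  \<comment> \<open>A trivial kernel yields a left inverse, which is two-sided because the Gram
    matrix is square.\<close>
  then show ?thesis
    by (metis invertible_left_inverse matrix_left_invertible_ker)
qed

text \<open>\<open>\<Phi> *v \<alpha>\<close> is the orthogonal projection of
  \<open>basis_vec \<phi> xt\<close> onto the column space of \<Phi>. The residual
  \<open>ROD_phi \<phi> xbar xt\<close> is thus orthogonal to \<open>\<Phi> *v l\<close>, so the
  multiplier drops out without being computed.\<close>

lemma expansion_ROD_solution:
  fixes \<phi> :: "'n::finite \<Rightarrow> 'a \<Rightarrow> real" and xbar :: "'k::finite \<Rightarrow> 'a"
  defines "\<Phi> \<equiv> collocation_matrix \<phi> xbar"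
  assumes gram: "invertible (transpose \<Phi> ** \<Phi>)"
    and sol: "ROD_solution \<Phi> u u\<^sub>D v l"
  shows "expansion \<phi> v xt = ROD_phi \<phi> xbar xt \<bullet> u + ROD_alpha \<phi> xbar xt \<bullet> u\<^sub>D"
proof -
  define y where "y = basis_vec \<phi> xt"
  define \<alpha> where "\<alpha> = ROD_alpha \<phi> xbar xt"
  have \<alpha>: "\<alpha> = (y v* \<Phi>) v* matrix_inv (transpose \<Phi> ** \<Phi>)"
    by (simp add: \<alpha>_def ROD_alpha_def y_def \<Phi>_def Let_def)
  have u: "u = v + \<Phi> *v l" and uD: "u\<^sub>D = transpose \<Phi> *v v"
    using sol by (simp_all add: ROD_solution_iff)
  have adj: "(\<Phi> *v \<alpha>) \<bullet> z = \<alpha> \<bullet> (transpose \<Phi> *v z)" for z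
    by (metis dot_lmul_matrix transpose_matrix_vector transpose_transpose)
  have "(\<Phi> *v \<alpha>) \<bullet> (\<Phi> *v l) = \<alpha> \<bullet> ((transpose \<Phi> ** \<Phi>) *v l)"
    by (simp add: adj matrix_vector_mul_assoc)
  \<comment> \<open>Moving the inverse across the inner product places it to the left of the Gram
    matrix, so the left inverse law applies.\<close>
  also have "\<dots> = (y v* \<Phi>) \<bullet> l"
    unfolding \<alpha> dot_lmul_matrix[of _ "matrix_inv _"] matrix_vector_mul_assoc
      matrix_inv_mult(2)[OF gram] by simp
  also have "\<dots> = y \<bullet> (\<Phi> *v l)"
    by (rule dot_lmul_matrix)
  \<comment> \<open>After substituting for \<open>u\<close> and \<open>u\<^sub>D\<close>, the chain
    above cancels the terms in \<open>l\<close>, and adjointness cancels the two terms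
    \<open>(\<Phi> *v \<alpha>) \<bullet> v\<close>.\<close>
  finally have "y \<bullet> v = (y - \<Phi> *v \<alpha>) \<bullet> u + \<alpha> \<bullet> u\<^sub>D"
    unfolding u uD adj[symmetric] by (simp add: inner_diff_left inner_add_right)
  then show ?thesis
    by (simp add: expansion_def ROD_phi_def y_def \<alpha>_def \<Phi>_def)
qed

text \<open>Gram invertibility is part of the conclusion so that \<open>matrix_inv\<close> in
  \<open>ROD_alpha\<close> denotes a genuine inverse; unique existence justifies speaking of the
  solution.\<close>

theorem proposition5p3:
  fixes p :: nat
    and \<phi> :: "'n::finite \<Rightarrow> real ^ 2 \<Rightarrow> real"
    and xbar :: "'k::finite \<Rightarrow> real ^ 2"
    and xt :: "real ^ 2"
  assumes "CARD('n) = (p + 1)\<^sup>2"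
    and "\<And>j. real_polynomial_function (\<phi> j)"
    and "linearly_independent_family \<phi>"
    and "invertible (ROD_matrix (collocation_matrix \<phi> xbar))"
  shows "invertible (transpose (collocation_matrix \<phi> xbar) ** collocation_matrix \<phi> xbar) \<and>
    (\<forall>u u\<^sub>D. (\<exists>!(v, l). ROD_solution (collocation_matrix \<phi> xbar) u u\<^sub>D v l) \<and>
      (\<forall>v l. ROD_solution (collocation_matrix \<phi> xbar) u u\<^sub>D v l \<longrightarrow>
         expansion \<phi> v xt = ROD_phi \<phi> xbar xt \<bullet> u + ROD_alpha \<phi> xbar xt \<bullet> u\<^sub>D))"
  by (intro conjI allI impI invertible_gram_matrix[OF assms(4)]
      ROD_solution_exists_unique[OF assms(4)]
      expansion_ROD_solution[OF invertible_gram_matrix[OF assms(4)]])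

end
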